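(* Let $n\geq 4$ and $0\le p\le 1$. In the $n$-dimensional bubble-sort network $B_n$ under the random node fault model in which each node is fault-free independently with probability $p$, $$P(3,1,0)=\tfrac{1}{6}(n^8-7n^7+21n^6-35n^5+34n^4-18n^3+4n^2)p^{4(n-2)!}+\tfrac{1}{2}(n^7-7n^6+21n^5-35n^4+34n^3-18n^2+4n)p^{4(n-2)!-(n-3)!}+\tfrac{1}{2}(n^6-8n^5+25n^4-40n^3+34n^2-12n)p^{4(n-2)!-2(n-3)!}+\tfrac{1}{6}(n^5-10n^4+35n^3-50n^2+24n)p^{4(n-2)!-3(n-3)!}.$$
   Context: Let $N_n=\{1,\dots,n\}$. The bubble-sort network $B_n$ has as vertices the permutations of $N_n$, written as strings $u_1u_2\cdots u_n$, two permutations being adjacent iff they differ by swapping two adjacent positions $u_i,u_{i+1}$. For distinct $a_1,a_2\in N_n$, a $B_{n-2}$-subnetwork of $B_n$ is one of the following vertex sets (each inducing a copy of $B_{n-2}$ and having $(n-2)!$ vertices): $a_1a_2X^{n-2}$, the set of permutations with $u_1=a_1,u_2=a_2$ ("prefix form"); $a_1X^{n-2}a_2$, the set with $u_1=a_1,u_n=a_2$ ("middle form"); $X^{n-2}a_1a_2$, the set with $u_{n-1}=a_1,u_n=a_2$ ("suffix form"). Each form gives $n(n-1)$ subnetworks. In the random node fault model each vertex is fault-free independently with probability $p$ (faulty with probability $1-p$); a subnetwork is fault-free if all its vertices are. For nonnegative integers $i,j,k$ with $i+j+k=4$, $P(i,j,k)$ denotes the sum, over all sets $S$ of four distinct $B_{n-2}$-subnetworks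 consisting of $i$ of prefix form, $j$ of middle form and $k$ of suffix form, of the probability that all four members of $S$ are fault-free, i.e. of $p^{|\bigcup_{H\in S}H|}$. (The paper calls $P(i,j,k)$ "the probability that there are four fault-free $B_{n-2}$'s, $i$ of which are of prefix form, $j$ of middle form and $k$ of suffix form".) *)

theory Defs
  imports
    "HOL-Probability.Probability"
    "HOL-Combinatorics.Multiset_Permutations"
    "Graph_Theory.Pair_Digraph"
begin

text \<open>
  A permutation \<open>u\<^sub>1 u\<^sub>2 \<dots> u\<^sub>n\<close> of \<open>{1..n}\<close> is a list, so that \<open>u\<^sub>i\<close> is \<open>u ! (i - 1)\<close>. The undirected
  network is a digraph with a symmetric set of arcs.
\<close>

definition bubble_sort_network :: "nat \<Rightarrow> nat list pair_pre_digraph" where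
  "bubble_sort_network n =
     \<lparr>pverts = permutations_of_set {1..n},
      parcs = {(u, v). u \<in> permutations_of_set {1..n} \<and>
                 (\<exists>i. Suc i < n \<and> v = u[i := u ! Suc i, Suc i := u ! i])}\<rparr>"

definition prefix_subnetwork :: "nat \<Rightarrow> nat \<Rightarrow> nat \<Rightarrow> nat list set" where
  "prefix_subnetwork n a b = {u \<in> pverts (bubble_sort_network n). u ! 0 = a \<and> u ! 1 = b}"

definition middle_subnetwork :: "nat \<Rightarrow> nat \<Rightarrow> nat \<Rightarrow> nat list set" where
  "middle_subnetwork n a b = {u \<in> pverts (bubble_sort_network n). u ! 0 = a \<and> u ! (n - 1) = b}"

definition suffix_subnetwork :: "nat \<Rightarrow> nat \<Rightarrow> nat \<Rightarrow> nat list set" where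
  "suffix_subnetwork n a b = {u \<in> pverts (bubble_sort_network n). u ! (n - 2) = a \<and> u ! (n - 1) = b}"

definition prefix_forms :: "nat \<Rightarrow> nat list set set" where
  "prefix_forms n = {prefix_subnetwork n a b | a b. a \<in> {1..n} \<and> b \<in> {1..n} \<and> a \<noteq> b}"

definition middle_forms :: "nat \<Rightarrow> nat list set set" where
  "middle_forms n = {middle_subnetwork n a b | a b. a \<in> {1..n} \<and> b \<in> {1..n} \<and> a \<noteq> b}"

definition suffix_forms :: "nat \<Rightarrow> nat list set set" where
  "suffix_forms n = {suffix_subnetwork n a b | a b. a \<in> {1..n} \<and> b \<in> {1..n} \<and> a \<noteq> b}"

text \<open>
  The sample points of the fault model are the functions that map a node to \<open>True\<close> iff it is
  fault-free; outside the vertex set they take the default value \<open>False\<close>.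
\<close>

definition node_fault_model :: "nat \<Rightarrow> real \<Rightarrow> (nat list \<Rightarrow> bool) pmf" where
  "node_fault_model n p =
     Pi_pmf (pverts (bubble_sort_network n)) False (\<lambda>_. bernoulli_pmf p)"

definition fault_free :: "(nat list \<Rightarrow> bool) \<Rightarrow> nat list set \<Rightarrow> bool" where
  "fault_free \<omega> H \<longleftrightarrow> (\<forall>u\<in>H. \<omega> u)"

definition four_subnetworks :: "nat \<Rightarrow> nat \<Rightarrow> nat \<Rightarrow> nat \<Rightarrow> nat list set set set" where
  "four_subnetworks n i j k =
     {S. S \<subseteq> prefix_forms n \<union> middle_forms n \<union> suffix_forms n \<and> card S = 4 \<and>
         card (S \<inter> prefix_forms n) = i \<and>
         card (S \<inter> middle_forms n) = j \<and>
         card (S \<inter> suffix_forms n) = k}"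

definition P :: "nat \<Rightarrow> real \<Rightarrow> nat \<Rightarrow> nat \<Rightarrow> nat \<Rightarrow> real" where
  "P n p i j k =
     (\<Sum>S\<in>four_subnetworks n i j k.
        measure_pmf.prob (node_fault_model n p) {\<omega>. \<forall>H\<in>S. fault_free \<omega> H})"

lemma finite_pverts [simp]: "finite (pverts (bubble_sort_network n))"
  by (simp add: bubble_sort_network_def)

lemma forms_subset:
  "prefix_forms n \<union> middle_forms n \<union> suffix_forms n \<subseteq> Pow (pverts (bubble_sort_network n))"
  by (auto simp: prefix_forms_def middle_forms_def suffix_forms_def
      prefix_subnetwork_def middle_subnetwork_def suffix_subnetwork_def)

lemma finite_four_subnetworks: "finite (four_subnetworks n i j k)"
proof (rule finite_subset)
  show "four_subnetworks n i j k \<subseteq> Pow (Pow (pverts (bubble_sort_network n)))"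
    using forms_subset unfolding four_subnetworks_def by blast
qed simp

lemma prob_fault_free:
  assumes p: "0 \<le> p" "p \<le> 1" and S: "S \<in> four_subnetworks n i j k"
  shows "measure_pmf.prob (node_fault_model n p) {\<omega>. \<forall>H\<in>S. fault_free \<omega> H} = p ^ card (\<Union>S)"
proof -
  define V where "V = pverts (bubble_sort_network n)"
  have V: "finite V" by (simp add: V_def)
  have "S \<subseteq> Pow V"
    using S forms_subset[of n] unfolding four_subnetworks_def V_def by blast
  then have U: "\<Union>S \<subseteq> V" by blast
  define B where "B = (\<lambda>u. if u \<in> \<Union>S then {True} else UNIV)"
  have "\<omega> \<in> Pi V B \<longleftrightarrow> (\<forall>u\<in>\<Union>S. \<omega> u)" for \<omega>
  proof -
    have "\<omega> \<in> Pi V B \<longleftrightarrow> (\<forall>u\<in>V. u \<in> \<Union>S \<longrightarrow> \<omega> u)"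
      by (simp add: Pi_iff B_def del: Union_iff cong: if_cong)
    then show ?thesis using U by blast
  qed
  then have "{\<omega>. \<forall>H\<in>S. fault_free \<omega> H} = Pi V B"
    by (auto simp: fault_free_def)
  then have "measure_pmf.prob (node_fault_model n p) {\<omega>. \<forall>H\<in>S. fault_free \<omega> H} =
      (\<Prod>u\<in>V. measure_pmf.prob (bernoulli_pmf p) (B u))"
    using V by (simp add: node_fault_model_def V_def[symmetric] measure_Pi_pmf_Pi)
  also have "\<dots> = (\<Prod>u\<in>V. if u \<in> \<Union>S then p else 1)"
    using p by (intro prod.cong) (simp_all add: B_def measure_pmf_single del: Union_iff)
  also have "\<dots> = (\<Prod>u\<in>\<Union>S. p)"
    using V U by (simp add: prod.If_cases Int_absorb1 del: Union_iff)
  also have "\<dots> = p ^ card (\<Union>S)" by simp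
  finally show ?thesis .
qed

end

theory Submission
  imports Defs
begin

text \<open>
  Distinct subnetworks of the same form are disjoint, and a prefix form \<open>a b X\<close> meets a middle form
  \<open>a' X c\<close> iff \<open>a = a'\<close> and \<open>b \<noteq> c\<close>, in which case they share \<open>(n - 3)!\<close> vertices. So a fixed middle
  form meets exactly \<open>n - 2\<close> of the \<open>n (n - 1)\<close> prefix forms, and three prefix forms of which \<open>r\<close>
  meet it have with it a union of \<open>4 (n - 2)! - r (n - 3)!\<close> vertices. It remains to sum over \<open>r\<close>.
\<close>

section \<open>Permutations with prescribed entries\<close>

lemma inj_on_insert_fun_upd:
  assumes "inj_on f I" "j \<notin> I" "x \<notin> f ` I"
  shows "inj_on (f(j := x)) (insert j I)"
  using inj_on_fun_updI[OF assms(1,3)] assms(2,3) by auto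

lemma card_permutations_of_set_prescribed:
  assumes "finite A" "I \<subseteq> {..<card A}" "inj_on f I" "f ` I \<subseteq> A"
  shows "card {u \<in> permutations_of_set A. \<forall>i\<in>I. u ! i = f i} = fact (card A - card I)"
  using assms(2-)
proof (induction "card A - card I" arbitrary: I f)
  case 0
  \<comment> \<open>With no free position left, \<open>f\<close> is a bijection from the positions
    onto \<open>A\<close>, so exactly one list remains.\<close>
  have I: "I = {..<card A}"
    using 0 by (intro card_subset_eq) (auto dest: card_mono[of "{..<card A}", rotated])
  then have img: "f ` {..<card A} = A"
    using 0 assms(1) by (intro card_subset_eq) (auto simp: card_image)
  have "{u \<in> permutations_of_set A. \<forall>i\<in>I. u ! i = f i} = {map f [0..<card A]}"
  proof (intro equalityI subsetI)
    fix u assume u: "u \<in> {u \<in> permutations_of_set A. \<forall>i\<in>I. u ! i = f i}"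
    then have "length u = card A" by (auto simp: length_finite_permutations_of_set)
    then show "u \<in> {map f [0..<card A]}" using u I by (auto intro!: nth_equalityI)
  next
    fix u assume "u \<in> {map f [0..<card A]}"
    then show "u \<in> {u \<in> permutations_of_set A. \<forall>i\<in>I. u ! i = f i}"
      using I img 0 by (auto simp: permutations_of_set_def distinct_map atLeast0LessThan)
  qed
  then show ?case using 0 by simp
next
  case (Suc m)
  have fin: "finite I" using Suc.prems finite_subset by blast
  have "I \<noteq> {..<card A}" using Suc.hyps(2) by auto
  then obtain j where j: "j < card A" "j \<notin> I" using Suc.prems by auto
  let ?X = "\<lambda>x. {u \<in> permutations_of_set A. \<forall>i\<in>insert j I. u ! i = (f(j := x)) i}"
  have card_X: "card (?X x) = fact m" if "x \<in> A - f ` I" for x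
  proof -
    have m: "m = card A - card (insert j I)" using Suc.hyps(2) j fin by simp
    have sub: "insert j I \<subseteq> {..<card A}" using Suc.prems j by simp
    have img: "(f(j := x)) ` insert j I \<subseteq> A" using Suc.prems that j by auto
    have inj: "inj_on (f(j := x)) (insert j I)"
      using Suc.prems that j by (intro inj_on_insert_fun_upd) auto
    show ?thesis using Suc.hyps(1)[OF m sub inj img] unfolding m[symmetric] .
  qed
  have "{u \<in> permutations_of_set A. \<forall>i\<in>I. u ! i = f i} = (\<Union>x\<in>A - f ` I. ?X x)"
  proof (intro equalityI subsetI)
    fix u assume u: "u \<in> {u \<in> permutations_of_set A. \<forall>i\<in>I. u ! i = f i}"
    then have len: "length u = card A" and dist: "distinct u" and set: "set u = A"
      by (auto simp: length_finite_permutations_of_set permutations_of_set_def)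
    have "u ! j \<notin> f ` I"
    proof
      assume "u ! j \<in> f ` I"
      then obtain i where "i \<in> I" "u ! j = u ! i" using u by auto
      moreover from this have "i < length u" using Suc.prems len by auto
      ultimately show False using j len dist by (auto simp: nth_eq_iff_index_eq)
    qed
    moreover have "u ! j \<in> A" using set len j nth_mem by metis
    ultimately show "u \<in> (\<Union>x\<in>A - f ` I. ?X x)" using u by auto
  next
    fix u assume "u \<in> (\<Union>x\<in>A - f ` I. ?X x)"
    then obtain x where "u \<in> permutations_of_set A" "\<forall>i\<in>insert j I. u ! i = (f(j := x)) i" by blast
    moreover have "(f(j := x)) i = f i" if "i \<in> I" for i using j that by auto
    ultimately show "u \<in> {u \<in> permutations_of_set A. \<forall>i\<in>I. u ! i = f i}" by simp
  qed
  also have "card \<dots> = (\<Sum>x\<in>A - f ` I. card (?X x))"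
    using assms(1) by (intro card_UN_disjoint) (auto intro: finite_subset)
  also have "\<dots> = card (A - f ` I) * fact m" using card_X by simp
  also have "card (A - f ` I) = Suc m"
    using Suc fin by (simp add: card_Diff_subset card_image)
  finally show ?case using Suc.hyps(2) by (metis fact_Suc of_nat_id)
qed

lemma permutations_of_set_prescribed_avoid:
  assumes "finite A" "I \<subseteq> {..<card A}" "inj_on f I" "f ` I \<subseteq> A"
    and "card I + 2 \<le> card A" "k < card A" "k \<notin> I"
  obtains u where "u \<in> permutations_of_set A" "\<forall>i\<in>I. u ! i = f i" "u ! k \<noteq> d"
proof -
  have fin: "finite I" using assms finite_subset by blast
  have "card (A - f ` I) = card A - card I"
    using assms fin by (simp add: card_Diff_subset card_image)
  then have "\<not> card (A - f ` I) \<le> card {d}" using assms by simp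
  then have "\<not> A - f ` I \<subseteq> {d}" using card_mono[of "{d}" "A - f ` I"] by blast
  then obtain x where x: "x \<in> A" "x \<notin> f ` I" "x \<noteq> d" by blast
  have sub: "insert k I \<subseteq> {..<card A}" using assms by simp
  have img: "(f(k := x)) ` insert k I \<subseteq> A" using assms x by auto
  have inj: "inj_on (f(k := x)) (insert k I)"
    using assms x by (intro inj_on_insert_fun_upd) auto
  \<comment> \<open>Existence follows from counting: with \<open>k\<close> prescribed as well, the
    number of permutations is a factorial, hence nonzero.\<close>
  have "card {u \<in> permutations_of_set A. \<forall>i\<in>insert k I. u ! i = (f(k := x)) i} \<noteq> 0"
    unfolding card_permutations_of_set_prescribed[OF assms(1) sub inj img] by simp
  then obtain u where "u \<in> permutations_of_set A" "\<forall>i\<in>insert k I. u ! i = (f(k := x)) i"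
    by (metis (mono_tags, lifting) card_eq_0_iff empty_Collect_eq)
  then show ?thesis using that[of u] x assms(7) by (metis fun_upd_other fun_upd_same insertCI)
qed

text \<open>The two zero-based positions are parameters, so that prefix, middle and suffix forms are
  all instances and share one set of lemmas.\<close>

definition perms_at :: "nat \<Rightarrow> nat \<Rightarrow> nat \<Rightarrow> nat \<Rightarrow> nat \<Rightarrow> nat list set" where
  "perms_at n i j a b = {u \<in> permutations_of_set {1..n}. u ! i = a \<and> u ! j = b}"

lemma finite_perms_at [simp]: "finite (perms_at n i j a b)"
  by (simp add: perms_at_def)

lemma card_perms_at:
  assumes "i < n" "j < n" "i \<noteq> j" "a \<in> {1..n}" "b \<in> {1..n}" "a \<noteq> b"
  shows "card (perms_at n i j a b) = fact (n - 2)"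
proof -
  have "perms_at n i j a b =
      {u \<in> permutations_of_set {1..n}. \<forall>k\<in>{i, j}. u ! k = (if k = i then a else b)}"
    using assms by (auto simp: perms_at_def)
  also have "card \<dots> = fact (card {1..n} - card {i, j})"
    using assms by (intro card_permutations_of_set_prescribed) (auto simp: inj_on_def)
  finally show ?thesis using assms by (simp add: numeral_2_eq_2)
qed

lemma perms_at_nonempty:
  assumes "i < n" "j < n" "i \<noteq> j" "a \<in> {1..n}" "b \<in> {1..n}" "a \<noteq> b"
  shows "perms_at n i j a b \<noteq> {}"
  using card_perms_at[OF assms] by force

text \<open>Position \<open>l\<close> is constrained in the second set but free in the first, so the
  first contains a permutation with an entry other than \<open>d\<close> there. The bound
  \<open>n \<ge> 4\<close> leaves two values for that entry.\<close>

lemma perms_at_neq: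
  assumes "i < n" "j < n" "i \<noteq> j" "a \<in> {1..n}" "b \<in> {1..n}" "a \<noteq> b"
    and "n \<ge> 4" "l < n" "l \<noteq> i" "l \<noteq> j"
  shows "perms_at n i j a b \<noteq> perms_at n k l c d"
proof -
  let ?f = "\<lambda>k. if k = i then a else b"
  have "{i, j} \<subseteq> {..<card {1..n}}" "inj_on ?f {i, j}" "?f ` {i, j} \<subseteq> {1..n}"
    "card {i, j} + 2 \<le> card {1..n}" "l < card {1..n}" "l \<notin> {i, j}"
    using assms by auto
  then obtain u where "u \<in> permutations_of_set {1..n}" "\<forall>k\<in>{i, j}. u ! k = ?f k" "u ! l \<noteq> d"
    using permutations_of_set_prescribed_avoid[of "{1..n}" "{i, j}" ?f l d] by blast
  then have "u \<in> perms_at n i j a b - perms_at n k l c d"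
    using assms by (auto simp: perms_at_def)
  then show ?thesis by blast
qed

lemma perms_at_disjoint:
  "(a, b) \<noteq> (a', b') \<Longrightarrow> perms_at n i j a b \<inter> perms_at n i j a' b' = {}"
  by (auto simp: perms_at_def)

text \<open>Different value pairs give disjoint sets, and disjoint sets can coincide only when
  empty.\<close>

lemma perms_at_inject:
  assumes "i < n" "j < n" "i \<noteq> j" "a \<in> {1..n}" "b \<in> {1..n}" "a \<noteq> b"
  shows "perms_at n i j a b = perms_at n i j a' b' \<longleftrightarrow> a = a' \<and> b = b'"
  using perms_at_nonempty[OF assms] perms_at_disjoint[of a b a' b' n i j] by auto

text \<open>The shared position \<open>i\<close> forces \<open>a = a'\<close>, and distinctness of
  entries forces \<open>b \<noteq> c\<close>. When both hold, three positions carry three distinct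
  prescribed values and the general count applies.\<close>

lemma card_perms_at_Int:
  assumes "i < n" "j < n" "k < n" "distinct [i, j, k]"
    and "a \<in> {1..n}" "b \<in> {1..n}" "c \<in> {1..n}" "a \<noteq> b" "a' \<noteq> c"
  shows "card (perms_at n i j a b \<inter> perms_at n i k a' c) =
    (if a = a' \<and> b \<noteq> c then fact (n - 3) else 0)"
proof (cases "a = a' \<and> b \<noteq> c")
  case True
  then have "perms_at n i j a b \<inter> perms_at n i k a' c =
      {u \<in> permutations_of_set {1..n}.
         \<forall>m\<in>{i, j, k}. u ! m = (if m = i then a else if m = j then b else c)}"
    using assms by (auto simp: perms_at_def)
  also have "card \<dots> = fact (card {1..n} - card {i, j, k})"
  proof (rule card_permutations_of_set_prescribed)
    let ?f = "\<lambda>m. if m = i then a else if m = j then b else c"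
    have "a \<noteq> b" "a \<noteq> c" "b \<noteq> c" "i \<noteq> j" "i \<noteq> k" "j \<noteq> k" using assms True by auto
    then show "inj_on ?f {i, j, k}" by simp
    show "?f ` {i, j, k} \<subseteq> {1..n}" using assms(5-7) by auto
    show "{i, j, k} \<subseteq> {..<card {1..n}}" using assms(1-3) by simp
  qed simp
  finally show ?thesis using assms True by (simp add: numeral_3_eq_3)
next
  case False
  have "perms_at n i j a b \<inter> perms_at n i k a' c = {}"
  proof (rule ccontr)
    assume "\<not> ?thesis"
    then obtain u where u: "u \<in> permutations_of_set {1..n}" "u ! i = a" "u ! i = a'"
        "u ! j = b" "u ! k = c"
      by (auto simp: perms_at_def)
    then have "length u = n" "distinct u"
      using length_finite_permutations_of_set[of u "{1..n}"]
      by (auto simp: permutations_of_set_def)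
    then show False using u assms False by (auto simp: nth_eq_iff_index_eq)
  qed
  then show ?thesis using False by simp
qed

section \<open>The forms of subnetworks\<close>

lemma
  shows prefix_subnetwork_eq: "prefix_subnetwork n = perms_at n 0 1"
    and middle_subnetwork_eq: "middle_subnetwork n = perms_at n 0 (n - 1)"
    and suffix_subnetwork_eq: "suffix_subnetwork n = perms_at n (n - 2) (n - 1)"
  by (simp_all add: fun_eq_iff perms_at_def prefix_subnetwork_def middle_subnetwork_def
      suffix_subnetwork_def bubble_sort_network_def)

lemma card_off_diagonal:
  assumes "finite A"
  shows "card {(a, b). a \<in> A \<and> b \<in> A \<and> a \<noteq> b} = card A * (card A - 1)"
proof -
  have "{(a, b). a \<in> A \<and> b \<in> A \<and> a \<noteq> b} = (SIGMA a:A. A - {a})" by auto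
  then show ?thesis using assms by (simp add: card_SigmaI)
qed

lemma card_perms_at_image:
  assumes "i < n" "j < n" "i \<noteq> j"
  shows "card {perms_at n i j a b | a b. a \<in> {1..n} \<and> b \<in> {1..n} \<and> a \<noteq> b} = n * (n - 1)"
proof -
  let ?D = "{(a, b). a \<in> {1..n} \<and> b \<in> {1..n} \<and> a \<noteq> b}"
  have "{perms_at n i j a b | a b. a \<in> {1..n} \<and> b \<in> {1..n} \<and> a \<noteq> b} =
      (\<lambda>(a, b). perms_at n i j a b) ` ?D" by auto
  moreover have "inj_on (\<lambda>(a, b). perms_at n i j a b) ?D"
    using assms by (auto simp: inj_on_def perms_at_inject)
  ultimately show ?thesis using card_off_diagonal[of "{1..n}"] by (simp add: card_image)
qed

lemma card_prefix_forms: "n \<ge> 2 \<Longrightarrow> card (prefix_forms n) = n * (n - 1)"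
  unfolding prefix_forms_def prefix_subnetwork_eq by (rule card_perms_at_image) auto

lemma card_middle_forms: "n \<ge> 2 \<Longrightarrow> card (middle_forms n) = n * (n - 1)"
  unfolding middle_forms_def middle_subnetwork_eq by (rule card_perms_at_image) auto

text \<open>This and the next two lemmas compare families of vertex sets: no vertex set has two
  forms, although members of different families may share vertices. Hence the form of each member of
  a set of subnetworks is unambiguous.\<close>

lemma prefix_forms_Int_middle_forms: "n \<ge> 4 \<Longrightarrow> prefix_forms n \<inter> middle_forms n = {}"
  by (auto simp: prefix_forms_def middle_forms_def prefix_subnetwork_eq middle_subnetwork_eq
      perms_at_neq)

lemma prefix_forms_Int_suffix_forms: "n \<ge> 4 \<Longrightarrow> prefix_forms n \<inter> suffix_forms n = {}"
  by (auto simp: prefix_forms_def suffix_forms_def prefix_subnetwork_eq suffix_subnetwork_eq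
      perms_at_neq)

lemma middle_forms_Int_suffix_forms:
  assumes "n \<ge> 4"
  shows "middle_forms n \<inter> suffix_forms n = {}"
proof -
  \<comment> \<open>A middle form already constrains position \<open>n - 1\<close>. Swapping the two
    positions of the suffix form puts \<open>n - 2\<close>, which the middle form leaves free, in
    the role of \<open>l\<close> in \<open>perms_at_neq\<close>.\<close>
  have "perms_at n (n - 2) (n - 1) c d = perms_at n (n - 1) (n - 2) d c" for c d
    by (auto simp: perms_at_def)
  then show ?thesis using assms
    by (auto simp: middle_forms_def suffix_forms_def middle_subnetwork_eq suffix_subnetwork_eq
        perms_at_neq)
qed

lemma finite_prefix_forms [simp]: "finite (prefix_forms n)"
  using forms_subset[of n] by (auto intro: finite_subset)

lemma card_prefix_forms_meeting_middle:
  assumes "n \<ge> 4" "H \<in> middle_forms n"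
  shows "card {G \<in> prefix_forms n. G \<inter> H \<noteq> {}} = n - 2"
proof -
  obtain a c where H: "H = perms_at n 0 (n - 1) a c" and ac: "a \<in> {1..n}" "c \<in> {1..n}" "a \<noteq> c"
    using assms by (auto simp: middle_forms_def middle_subnetwork_eq)
  \<comment> \<open>Nonemptiness is read off the size of the intersection, since a factorial is
    never zero.\<close>
  have meet: "perms_at n 0 1 a' b \<inter> H \<noteq> {} \<longleftrightarrow> a' = a \<and> b \<noteq> c"
    if "a' \<in> {1..n}" "b \<in> {1..n}" "a' \<noteq> b" for a' b
    using card_perms_at_Int[of 0 n 1 "n - 1" a' b c a] that ac assms(1)
    by (force simp: H card_eq_0_iff split: if_splits)
  have "{G \<in> prefix_forms n. G \<inter> H \<noteq> {}} =
      {perms_at n 0 1 a' b | a' b. a' \<in> {1..n} \<and> b \<in> {1..n} \<and> a' \<noteq> b \<and> a' = a \<and> b \<noteq> c}"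
    unfolding prefix_forms_def prefix_subnetwork_eq using meet by blast
  \<comment> \<open>Once \<open>a' = a\<close>, the value \<open>b\<close> must avoid
    \<open>a\<close> as a prefix form has distinct entries, and must avoid \<open>c\<close> in order
    to meet \<open>H\<close>.\<close>
  also have "\<dots> = perms_at n 0 1 a ` ({1..n} - {a, c})"
    using ac by auto
  finally have "{G \<in> prefix_forms n. G \<inter> H \<noteq> {}} = perms_at n 0 1 a ` ({1..n} - {a, c})" .
  moreover have "inj_on (perms_at n 0 1 a) ({1..n} - {a, c})"
    using assms(1) ac by (auto simp: inj_on_def perms_at_inject)
  ultimately show ?thesis using ac by (simp add: card_image card_Diff_subset numeral_2_eq_2)
qed

text \<open>Inclusion-exclusion for \<open>H\<close> and \<open>\<Union>T\<close>. The members of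
  \<open>T\<close> are pairwise disjoint, so both the size of \<open>\<Union>T\<close> and that of
  its overlap with \<open>H\<close> are sums over \<open>T\<close>.\<close>

lemma card_Union_prefix_forms_middle_form:
  assumes n: "n \<ge> 4" and H: "H \<in> middle_forms n" and T: "T \<subseteq> prefix_forms n"
  shows "card (\<Union>(insert H T)) =
    (card T + 1) * fact (n - 2) - card (T \<inter> {G \<in> prefix_forms n. G \<inter> H \<noteq> {}}) * fact (n - 3)"
proof -
  obtain a c where Heq: "H = perms_at n 0 (n - 1) a c"
    and ac: "a \<in> {1..n}" "c \<in> {1..n}" "a \<noteq> c"
    using H by (auto simp: middle_forms_def middle_subnetwork_eq)
  have finT: "finite T" using T by (rule finite_subset) simp
  have finG: "\<And>G. G \<in> T \<Longrightarrow> finite G"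
    using T by (auto simp: prefix_forms_def prefix_subnetwork_eq)
  have disj: "G \<inter> G' = {}" if "G \<in> T" "G' \<in> T" "G \<noteq> G'" for G G'
  proof -
    have "\<exists>a b. G = perms_at n 0 1 a b" "\<exists>a b. G' = perms_at n 0 1 a b"
      using that T by (auto simp: prefix_forms_def prefix_subnetwork_eq)
    then show ?thesis using that(3) by (auto simp: perms_at_def)
  qed
  have cardH: "card H = fact (n - 2)" using n ac by (simp add: Heq card_perms_at)
  have cardG: "card G = fact (n - 2)" if "G \<in> T" for G
    using that T n by (auto simp: prefix_forms_def prefix_subnetwork_eq card_perms_at)
  have cardGH: "card (G \<inter> H) = (if G \<inter> H \<noteq> {} then fact (n - 3) else 0)" if G: "G \<in> T" for G
  proof -
    obtain a' b where "G = perms_at n 0 1 a' b" "a' \<in> {1..n}" "b \<in> {1..n}" "a' \<noteq> b"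
      using G T by (auto simp: prefix_forms_def prefix_subnetwork_eq)
    then have "card (G \<inter> H) = (if a' = a \<and> b \<noteq> c then fact (n - 3) else 0)"
      using card_perms_at_Int[of 0 n 1 "n - 1" a' b c a] ac n by (simp add: Heq)
    moreover have "card (G \<inter> H) = 0 \<longleftrightarrow> G \<inter> H = {}" using finG[OF G] by simp
    ultimately show ?thesis by (auto split: if_splits)
  qed
  have "card (\<Union>T) = (\<Sum>G\<in>T. card G)"
    using card_UN_disjoint[of T "\<lambda>G. G"] finT finG disj by simp
  then have cT: "card (\<Union>T) = card T * fact (n - 2)" using cardG by simp
  have "card (\<Union>T \<inter> H) = card (\<Union>G\<in>T. G \<inter> H)" by (simp add: Int_Union2 Int_commute)
  also have "\<dots> = (\<Sum>G\<in>T. card (G \<inter> H))"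
    using finT finG disj by (intro card_UN_disjoint) auto
  also have "\<dots> = (\<Sum>G\<in>T. if G \<inter> H \<noteq> {} then fact (n - 3) else 0)"
    by (rule sum.cong) (simp_all add: cardGH)
  also have "\<dots> = (\<Sum>G | G \<in> T \<and> G \<inter> H \<noteq> {}. fact (n - 3))"
    using finT by (rule sum.inter_filter[symmetric])
  also have "{G. G \<in> T \<and> G \<inter> H \<noteq> {}} = T \<inter> {G \<in> prefix_forms n. G \<inter> H \<noteq> {}}" using T by auto
  finally have cI: "card (\<Union>T \<inter> H) =
      card (T \<inter> {G \<in> prefix_forms n. G \<inter> H \<noteq> {}}) * fact (n - 3)" by simp
  have "finite (\<Union>T)" "finite H" using finT finG by (auto simp: Heq)
  \<comment> \<open>The natural subtraction does not truncate, as the overlap is no larger than the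
    sum of the two sizes.\<close>
  from card_Un_Int[OF this] show ?thesis by (simp add: cT cI cardH Un_commute)
qed

section \<open>Summation over the sets of subnetworks\<close>

text \<open>A set \<open>T\<close> amounts to independent choices of \<open>T \<inter> K\<close>
  inside \<open>K\<close> and \<open>T - K\<close> inside \<open>F - K\<close>. The bound
  \<open>r \<le> m\<close> keeps \<open>m - r\<close> from truncating.\<close>

lemma card_subsets_with_intersection:
  assumes "finite F" "K \<subseteq> F" "r \<le> m"
  shows "card {T. T \<subseteq> F \<and> card T = m \<and> card (T \<inter> K) = r} =
    (card K choose r) * (card F - card K choose (m - r))"
proof -
  have finK: "finite K" using assms finite_subset by blast
  let ?A = "{U. U \<subseteq> K \<and> card U = r}" and ?B = "{V. V \<subseteq> F - K \<and> card V = m - r}"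
  have cardUn: "card (U \<union> V) = card U + card V" if "U \<subseteq> K" "V \<subseteq> F - K" for U V
    using that assms(1) finK by (intro card_Un_disjoint) (auto intro: finite_subset)
  have "bij_betw (\<lambda>(U, V). U \<union> V) (?A \<times> ?B) {T. T \<subseteq> F \<and> card T = m \<and> card (T \<inter> K) = r}"
  proof (rule bij_betw_byWitness[where f' = "\<lambda>T. (T \<inter> K, T - K)"])
    show "(\<lambda>(U, V). U \<union> V) ` (?A \<times> ?B) \<subseteq> {T. T \<subseteq> F \<and> card T = m \<and> card (T \<inter> K) = r}"
    proof clarsimp
      fix U V assume UV: "U \<subseteq> K" "V \<subseteq> F - K" "card V = m - card U" "r = card U"
      then have "(U \<union> V) \<inter> K = U" by auto
      then show "U \<subseteq> F \<and> V \<subseteq> F \<and> card (U \<union> V) = m \<and> card ((U \<union> V) \<inter> K) = card U"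
        using UV assms cardUn[of U V] by auto
    qed
    show "(\<lambda>T. (T \<inter> K, T - K)) ` {T. T \<subseteq> F \<and> card T = m \<and> card (T \<inter> K) = r} \<subseteq> ?A \<times> ?B"
      using finK by (auto simp: card_Diff_subset_Int)
  qed auto
  from bij_betw_same_card[OF this] show ?thesis
    using assms finK by (simp add: card_cartesian_product n_subsets card_Diff_subset)
qed

text \<open>The summand depends only on the intersection size, so the sets are grouped by it and
  each group is counted by the previous lemma.\<close>

lemma sum_subsets_by_intersection:
  fixes g :: "nat \<Rightarrow> 'a::comm_semiring_1"
  assumes "finite F" "K \<subseteq> F"
  shows "(\<Sum>T | T \<subseteq> F \<and> card T = m. g (card (T \<inter> K))) =
    (\<Sum>r\<le>m. of_nat ((card K choose r) * (card F - card K choose (m - r))) * g r)"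
proof -
  let ?S = "{T. T \<subseteq> F \<and> card T = m}"
  have fin: "finite ?S" using assms by simp
  have "card (T \<inter> K) \<le> m" if "T \<in> ?S" for T
    using that assms(1) by (auto intro!: card_mono intro: finite_subset)
  then have "(\<lambda>T. card (T \<inter> K)) ` ?S \<subseteq> {..m}" by auto
  from sum.group[OF fin _ this, of "\<lambda>T. g (card (T \<inter> K))"]
  have "(\<Sum>T\<in>?S. g (card (T \<inter> K))) =
      (\<Sum>r\<le>m. \<Sum>T | T \<in> ?S \<and> card (T \<inter> K) = r. g (card (T \<inter> K)))" by simp
  also have "\<dots> = (\<Sum>r\<le>m. of_nat (card {T. T \<subseteq> F \<and> card T = m \<and> card (T \<inter> K) = r}) * g r)"
    by (intro sum.cong) (simp_all add: conj_assoc)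
  finally show ?thesis
    using card_subsets_with_intersection[OF assms] by simp
qed

text \<open>As the families are disjoint, \<open>S\<close> corresponds to the pair of its only
  middle form \<open>H\<close> and its set \<open>T\<close> of three prefix forms, both recoverable
  from \<open>S\<close>.\<close>

lemma sum_four_subnetworks_3_1_0:
  assumes "n \<ge> 4"
  shows "(\<Sum>S\<in>four_subnetworks n 3 1 0. g S) =
    (\<Sum>H\<in>middle_forms n. \<Sum>T | T \<subseteq> prefix_forms n \<and> card T = 3. g (insert H T))"
proof -
  note disj = prefix_forms_Int_middle_forms[OF assms] prefix_forms_Int_suffix_forms[OF assms]
    middle_forms_Int_suffix_forms[OF assms]
  let ?X = "middle_forms n \<times> {T. T \<subseteq> prefix_forms n \<and> card T = 3}"
  have "bij_betw (\<lambda>(H, T). insert H T) ?X (four_subnetworks n 3 1 0)"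
  proof (rule bij_betw_byWitness
      [where f' = "\<lambda>S. (the_elem (S \<inter> middle_forms n), S \<inter> prefix_forms n)"])
    have middle: "insert H T \<inter> middle_forms n = {H}"
      if "H \<in> middle_forms n" "T \<subseteq> prefix_forms n" for H T using that disj by auto
    have pre: "insert H T \<inter> prefix_forms n = T"
      if "H \<in> middle_forms n" "T \<subseteq> prefix_forms n" for H T using that disj by auto
    show "\<forall>x\<in>?X. (\<lambda>S. (the_elem (S \<inter> middle_forms n), S \<inter> prefix_forms n))
        ((\<lambda>(H, T). insert H T) x) = x"
    proof
      fix x assume "x \<in> ?X"
      then obtain H T where x: "x = (H, T)" and HT: "H \<in> middle_forms n" "T \<subseteq> prefix_forms n"
        by blast
      show "(\<lambda>S. (the_elem (S \<inter> middle_forms n), S \<inter> prefix_forms n))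
          ((\<lambda>(H, T). insert H T) x) = x"
        unfolding x prod.case middle[OF HT] pre[OF HT] by simp
    qed
    show "(\<lambda>(H, T). insert H T) ` ?X \<subseteq> four_subnetworks n 3 1 0"
    proof clarify
      fix H T assume HT: "H \<in> middle_forms n" "T \<subseteq> prefix_forms n" "card T = 3"
      have "finite T" using HT(2) by (rule finite_subset) simp
      moreover have "H \<notin> T" "insert H T \<inter> suffix_forms n = {}" using HT disj by auto
      ultimately show "insert H T \<in> four_subnetworks n 3 1 0"
        using HT middle pre by (auto simp: four_subnetworks_def)
    qed
    have S: "\<exists>H. H \<in> middle_forms n \<and> S \<inter> middle_forms n = {H} \<and>
        S = insert H (S \<inter> prefix_forms n) \<and> card (S \<inter> prefix_forms n) = 3"
      if S: "S \<in> four_subnetworks n 3 1 0" for S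
    proof -
      have "card S = 4" using S by (simp add: four_subnetworks_def)
      \<comment> \<open>Infinite sets have \<open>card\<close> equal to 0, so finiteness is needed
        before a zero count of suffix forms can mean that there are none.\<close>
      then have "finite S" by (metis card.infinite zero_neq_numeral)
      then have suffix: "S \<inter> suffix_forms n = {}" using S by (auto simp: four_subnetworks_def)
      have sub: "S \<subseteq> prefix_forms n \<union> middle_forms n \<union> suffix_forms n"
        and card: "card (S \<inter> prefix_forms n) = 3"
        using S by (simp_all add: four_subnetworks_def)
      obtain H where H: "S \<inter> middle_forms n = {H}"
        using S by (auto simp: four_subnetworks_def card_1_singleton_iff)
      have "S = (S \<inter> middle_forms n) \<union> (S \<inter> prefix_forms n)" using sub suffix by blast
      then have "S = insert H (S \<inter> prefix_forms n)" unfolding H by simp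
      then show ?thesis using H card by blast
    qed
    show "\<forall>S\<in>four_subnetworks n 3 1 0.
        (\<lambda>(H, T). insert H T) (the_elem (S \<inter> middle_forms n), S \<inter> prefix_forms n) = S"
      using S by fastforce
    show "(\<lambda>S. (the_elem (S \<inter> middle_forms n), S \<inter> prefix_forms n)) ` four_subnetworks n 3 1 0
        \<subseteq> ?X"
      using S by fastforce
  qed
  then have "(\<Sum>S\<in>four_subnetworks n 3 1 0. g S) = (\<Sum>(H, T)\<in>?X. g (insert H T))"
    by (simp add: sum.reindex_bij_betw[symmetric] case_prod_unfold)
  then show ?thesis by (simp add: sum.cartesian_product)
qed

text \<open>Subtraction is in the reals, so the formula also covers \<open>m < 3\<close>, where a
  factor vanishes. This matters for \<open>n - 2 choose 3\<close> when \<open>n = 4\<close>.\<close>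

lemma real_choose_three: "real (m choose 3) = real m * (real m - 1) * (real m - 2) / 6"
  by (simp add: binomial_gbinomial gbinomial_prod_rev numeral_3_eq_3 fact_numeral)

lemma real_choose_two: "real (m choose 2) = real m * (real m - 1) / 2"
  by (simp add: binomial_gbinomial gbinomial_prod_rev numeral_2_eq_2)

theorem theorem2:
  fixes n :: nat and p :: real
  assumes "n \<ge> 4" and "0 \<le> p" and "p \<le> 1"
  shows "P n p 3 1 0 =
      1 / 6 * (real n ^ 8 - 7 * real n ^ 7 + 21 * real n ^ 6 - 35 * real n ^ 5
               + 34 * real n ^ 4 - 18 * real n ^ 3 + 4 * real n ^ 2)
        * p ^ (4 * fact (n - 2))
    + 1 / 2 * (real n ^ 7 - 7 * real n ^ 6 + 21 * real n ^ 5 - 35 * real n ^ 4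
               + 34 * real n ^ 3 - 18 * real n ^ 2 + 4 * real n)
        * p ^ (4 * fact (n - 2) - fact (n - 3))
    + 1 / 2 * (real n ^ 6 - 8 * real n ^ 5 + 25 * real n ^ 4 - 40 * real n ^ 3
               + 34 * real n ^ 2 - 12 * real n)
        * p ^ (4 * fact (n - 2) - 2 * fact (n - 3))
    + 1 / 6 * (real n ^ 5 - 10 * real n ^ 4 + 35 * real n ^ 3 - 50 * real n ^ 2
               + 24 * real n)
        * p ^ (4 * fact (n - 2) - 3 * fact (n - 3))"
proof -
  \<comment> \<open>\<open>q r\<close> is the probability attached to a set whose middle form meets
    \<open>r\<close> of its prefix forms; \<open>c\<close> is the number of prefix forms disjoint
    from a fixed middle form.\<close>
  define q where "q r = p ^ (4 * fact (n - 2) - r * fact (n - 3))" for r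
  define c where "c = n * (n - 1) - (n - 2)"
  have "P n p 3 1 0 = (\<Sum>S\<in>four_subnetworks n 3 1 0. p ^ card (\<Union>S))"
    using assms by (simp add: P_def prob_fault_free)
  also have "\<dots> = (\<Sum>H\<in>middle_forms n. \<Sum>T | T \<subseteq> prefix_forms n \<and> card T = 3.
      p ^ card (\<Union>(insert H T)))"
    using assms(1) by (rule sum_four_subnetworks_3_1_0)
  also have "\<dots> = (\<Sum>H\<in>middle_forms n. \<Sum>T | T \<subseteq> prefix_forms n \<and> card T = 3.
      q (card (T \<inter> {G \<in> prefix_forms n. G \<inter> H \<noteq> {}})))"
  proof (intro sum.cong refl)
    fix H T assume "H \<in> middle_forms n" "T \<in> {T. T \<subseteq> prefix_forms n \<and> card T = 3}"
    then show "p ^ card (\<Union>(insert H T)) = q (card (T \<inter> {G \<in> prefix_forms n. G \<inter> H \<noteq> {}}))"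
      using card_Union_prefix_forms_middle_form[OF assms(1), of H T] by (simp add: q_def)
  qed
  also have "\<dots> = (\<Sum>H\<in>middle_forms n. \<Sum>r\<le>3. real ((n - 2 choose r) * (c choose (3 - r))) * q r)"
    using assms(1)
    by (intro sum.cong refl, subst sum_subsets_by_intersection)
       (auto simp: card_prefix_forms card_prefix_forms_meeting_middle c_def)
  \<comment> \<open>The inner sum no longer depends on \<open>H\<close>, so the outer one
    contributes only the number of middle forms.\<close>
  also have "\<dots> = real (n * (n - 1)) *
      (\<Sum>r\<le>3. real ((n - 2 choose r) * (c choose (3 - r))) * q r)"
    using assms(1) by (simp add: card_middle_forms)
  also have "(\<Sum>r\<le>3. real ((n - 2 choose r) * (c choose (3 - r))) * q r) =
      real (c choose 3) * q 0 + real (n - 2) * real (c choose 2) * q 1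
      + real (n - 2 choose 2) * real c * q 2 + real (n - 2 choose 3) * q 3"
    by (simp add: numeral_eq_Suc)
  finally have *: "P n p 3 1 0 = real (n * (n - 1)) * \<dots>" .
  \<comment> \<open>This makes the subtraction in \<open>c\<close> exact, so that \<open>c\<close>
    becomes the polynomial \<open>n^2 - 2 * n + 2\<close> over the reals.\<close>
  have "n - 2 \<le> n * (n - 1)" using assms(1) by (simp add: diff_le_mono2 trans_le_add1 mult_eq_if)
  then have c: "real c = real n ^ 2 - 2 * real n + 2" and d: "real (n - 2) = real n - 2"
    and e: "real (n * (n - 1)) = real n * (real n - 1)"
    using assms(1) by (simp_all add: c_def of_nat_diff algebra_simps power2_eq_square)
  have q: "p ^ (4 * fact (n - 2)) = q 0" "p ^ (4 * fact (n - 2) - fact (n - 3)) = q 1"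
    "p ^ (4 * fact (n - 2) - 2 * fact (n - 3)) = q 2"
    "p ^ (4 * fact (n - 2) - 3 * fact (n - 3)) = q 3"
    by (simp_all add: q_def)
  \<comment> \<open>With the powers of \<open>p\<close> abstracted to \<open>q 0\<close>, ...,
    \<open>q 3\<close>, only a polynomial identity in \<open>n\<close>, linear in these four, is
    left.\<close>
  show ?thesis
    unfolding * q real_choose_three real_choose_two c d e
    by (simp add: field_simps) algebra
qed

end
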